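(* Let $a$, $b$, $c$ and $n$ be positive integers with $\gcd(a,b)=\gcd(b,c)=\gcd(c,a)=1$, and let $N(a,b,c;n)$ denote the number of triples $(x,y,z)$ of nonnegative integers satisfying $ax+by+cz=n$. Then $$\frac{n(n+a+b+c)}{2abc}-\frac{a+b+c}{2} \;<\; N(a,b,c;n) \;<\; \frac{n(n+a+b+c)}{2abc}+\frac{a+b+c}{2}.$$ *)

theory Defs
  imports Complex_Main
begin

definition num_sols :: "nat \<Rightarrow> nat \<Rightarrow> nat \<Rightarrow> nat \<Rightarrow> nat" where
  "num_sols a b c n = card {(x :: nat, y :: nat, z :: nat). a * x + b * y + c * z = n}"

end

theory Submission
  imports Defs
begin

text \<open>
  Fix \<open>z\<close> and count the pairs \<open>(x, y)\<close> with \<open>a x + b y = m\<close>, where \<open>m = n - c z\<close>, by Popoviciu's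
  formula: there are \<open>m / (a b) + 1 - u / b - v / a\<close> of them, where \<open>u < b\<close> and \<open>v < a\<close> solve
  \<open>a u \<equiv> m (mod b)\<close> and \<open>b v \<equiv> m (mod a)\<close>. As \<open>z\<close> runs through \<open>0, \<dots>, n div c\<close>, the residue \<open>v\<close>
  takes distinct values on every window of length \<open>a\<close>, so its sum differs from that of its mean
  \<open>(a - 1) / 2\<close> by at most \<open>a\<^sup>2 / 8\<close>; likewise for \<open>u\<close>. With \<open>u\<close> and \<open>v\<close> replaced by their means,
  the sum over \<open>z\<close> is exactly \<open>n (n + a + b + c) / (2 a b c) + (c - r) (r + a + b) / (2 a b c)\<close>
  with \<open>r = n mod c\<close>. Hence the total error lies between \<open>- (a + b) / 8\<close> and
  \<open>(a + b + c) / 8 + 1 / (2 a) + 1 / (2 b)\<close>.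
\<close>

section \<open>Sums of distinct residues\<close>

text \<open>Adding a new maximum \<open>m\<close> to \<open>S\<close> adds at least
  \<open>card S\<close>, because \<open>S\<close> lies in \<open>{..<m}\<close>; the extremal case
  is an initial segment.\<close>

lemma double_sum_ge_card:
  fixes S :: "nat set"
  assumes "finite S"
  shows "card S * (card S - 1) \<le> 2 * \<Sum>S"
  using assms
proof (induction S rule: finite_linorder_max_induct)
  case empty
  then show ?case by simp
next
  case (insert m S)
  have "S \<subseteq> {..<m}"
    using insert.hyps by auto
  then have "card S \<le> m"
    by (metis card_lessThan card_mono finite_lessThan)
  moreover have "m \<notin> S"
    using insert.hyps by auto
  moreover have "card S * (card S + 1) = card S * (card S - 1) + 2 * card S"
    by (cases "card S") auto
  ultimately show ?case
    using insert.hyps insert.IH by (simp add: algebra_simps)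
qed

text \<open>The minimal sum of \<open>k\<close> distinct naturals bounds the sum of \<open>f\<close>
  from below, and, applied to the reflection \<open>a - 1 - f z\<close>, from above. The bound
  vanishes for \<open>k = a\<close>.\<close>

lemma sum_distinct_residues_deviation:
  fixes f :: "nat \<Rightarrow> nat"
  assumes inj: "inj_on f {..<k}" and less: "\<And>z. f z < a"
  shows "\<bar>(\<Sum>z<k. real (f z) - (real a - 1) / 2)\<bar> \<le> real k * (real a - real k) / 2"
proof (cases "k = 0")
  case False
  have lower: "real k * (real k - 1) \<le> 2 * (\<Sum>z<k. real (g z))"
    if "inj_on g {..<k}" for g :: "nat \<Rightarrow> nat"
  proof -
    have "k * (k - 1) \<le> 2 * (\<Sum>z<k. g z)"
      using double_sum_ge_card[of "g ` {..<k}"] that by (simp add: card_image sum.reindex)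
    then have "real (k * (k - 1)) \<le> real (2 * (\<Sum>z<k. g z))"
      by (simp only: of_nat_le_iff)
    then show ?thesis
      using False by (simp add: of_nat_diff)
  qed
  have "inj_on (\<lambda>z. a - 1 - f z) {..<k}"
  proof (rule inj_onI)
    fix x y assume "x \<in> {..<k}" "y \<in> {..<k}" "a - 1 - f x = a - 1 - f y"
    moreover from this have "f x = f y"
      using less[of x] less[of y] by linarith
    ultimately show "x = y"
      using inj by (auto dest: inj_onD)
  qed
  from lower[OF this]
  have "real k * (real k - 1) \<le> 2 * (\<Sum>z<k. real (a - 1 - f z))" .
  also have "(\<Sum>z<k. real (a - 1 - f z)) = (\<Sum>z<k. (real a - 1) - real (f z))"
  proof (rule sum.cong)
    fix z
    show "real (a - 1 - f z) = real a - 1 - real (f z)"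
      using less[of z] by linarith
  qed simp
  finally have upper: "real k * (real k - 1) \<le> 2 * (real k * (real a - 1) - (\<Sum>z<k. real (f z)))"
    by (simp add: sum_subtractf)
  have "(\<Sum>z<k. real (f z) - (real a - 1) / 2) = (\<Sum>z<k. real (f z)) - real k * (real a - 1) / 2"
    by (simp add: sum_subtractf)
  then show ?thesis
    using lower[OF inj] upper by (simp only: abs_le_iff) (simp add: field_simps)
qed simp

text \<open>A full window of length \<open>a\<close> contributes exactly 0, so windows are removed
  until fewer than \<open>a\<close> terms remain; then \<open>L * (a - L) / 2\<close> is largest at
  \<open>L = a / 2\<close>.\<close>

lemma sum_windowed_residues_deviation:
  fixes f :: "nat \<Rightarrow> nat"
  assumes inj: "\<And>k. inj_on f {k..<k + a}" and less: "\<And>z. f z < a"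
  shows "\<bar>(\<Sum>z<L. real (f z) - (real a - 1) / 2)\<bar> \<le> (real a)\<^sup>2 / 8"
  using assms
proof (induction L arbitrary: f rule: less_induct)
  case (less L)
  have a: "a > 0"
    using less.prems(2)[of 0] by simp
  show ?case
  proof (cases "L < a")
    case True
    have "inj_on f {..<L}"
      by (rule inj_on_subset[OF less.prems(1)[of 0]]) (use True in auto)
    from sum_distinct_residues_deviation[OF this less.prems(2)]
    have "\<bar>(\<Sum>z<L. real (f z) - (real a - 1) / 2)\<bar> \<le> real L * (real a - real L) / 2" .
    also have "\<dots> \<le> (real a)\<^sup>2 / 8"
      using zero_le_power2[of "real a - 2 * real L"] by (simp add: power2_eq_square algebra_simps)
    finally show ?thesis .
  next
    case False
    have "inj_on f {..<a}"
      using less.prems(1)[of 0] by (simp add: atLeast0LessThan)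
    from sum_distinct_residues_deviation[OF this less.prems(2)]
    have full: "(\<Sum>z<a. real (f z) - (real a - 1) / 2) = 0"
      by simp
    define g where "g = (\<lambda>z. f (z + a))"
    have "(\<Sum>z<L. real (f z) - (real a - 1) / 2)
        = (\<Sum>z<a. real (f z) - (real a - 1) / 2) + (\<Sum>z=a..<L. real (f z) - (real a - 1) / 2)"
      using False sum.atLeastLessThan_concat[of 0 a L "\<lambda>z. real (f z) - (real a - 1) / 2"]
      by (simp add: atLeast0LessThan)
    also have "(\<Sum>z=a..<L. real (f z) - (real a - 1) / 2) = (\<Sum>z<L - a. real (g z) - (real a - 1) / 2)"
      using sum.shift_bounds_nat_ivl[of "\<lambda>z. real (f z) - (real a - 1) / 2" 0 a "L - a"] False
      by (simp add: g_def atLeast0LessThan)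
    finally have "(\<Sum>z<L. real (f z) - (real a - 1) / 2) = (\<Sum>z<L - a. real (g z) - (real a - 1) / 2)"
      using full by simp
    moreover have "inj_on g {k..<k + a}" for k
    proof (rule inj_onI)
      fix x y assume xy: "x \<in> {k..<k + a}" "y \<in> {k..<k + a}" "g x = g y"
      have "x + a = y + a"
        by (rule inj_onD[OF less.prems(1)[of "k + a"]]) (use xy in \<open>auto simp: g_def\<close>)
      then show "x = y" by simp
    qed
    moreover have "g z < a" for z
      unfolding g_def by (rule less.prems(2))
    moreover have "L - a < L"
      using False a by simp
    ultimately show ?thesis
      using less.IH[of "L - a" g] by presburger
  qed
qed

section \<open>Residues modulo \<open>a\<close> and the equation in two variables\<close>

text \<open>\<open>v z\<close> is \<open>n - c z\<close> times the inverse of \<open>b\<close>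
  modulo \<open>a\<close>. As \<open>c\<close> is invertible too, equal values force indices
  congruent modulo \<open>a\<close>. Working in the integers covers windows where
  \<open>n - c z\<close> is negative.\<close>

lemma obtain_window_injective_residues:
  fixes a b c n :: nat
  assumes a: "a > 0" and ab: "coprime a b" and ac: "coprime a c"
  obtains v :: "nat \<Rightarrow> nat" where "\<And>z. v z < a"
    and "\<And>z. int a dvd int n - int c * int z - int b * int (v z)"
    and "\<And>k. inj_on v {k..<k + a}"
proof -
  have "\<exists>w<a. int a dvd m - int b * int w" for m :: int
  proof -
    \<comment> \<open>The coefficient \<open>q\<close> is the inverse of \<open>b\<close> modulo
      \<open>a\<close>.\<close>
    obtain p q where pq: "p * int a + q * int b = 1"
      using bezout_int[of "int a" "int b"] ab by (auto simp: coprime_iff_gcd_eq_1)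
    define w where "w = nat ((q * m) mod int a)"
    have w: "int w = (q * m) mod int a"
      using a by (simp add: w_def)
    have "w < a"
      using a by (simp add: w_def nat_less_iff)
    moreover have "m - int b * int w = int a * (p * m + int b * ((q * m) div int a))"
    proof -
      have "(q * m) mod int a = q * m - int a * ((q * m) div int a)"
        by (simp add: minus_mult_div_eq_mod)
      then have "m - int b * int w = m * (1 - q * int b) + int a * (int b * ((q * m) div int a))"
        unfolding w by (simp only:) (simp add: algebra_simps)
      also have "1 - q * int b = p * int a"
        using pq by simp
      finally show ?thesis
        by (simp add: algebra_simps)
    qed
    ultimately show ?thesis
      by (auto intro!: exI[of _ w])
  qed
  then have "\<forall>z. \<exists>w<a. int a dvd int n - int c * int z - int b * int w"
    by blast
  then obtain v where less: "\<And>z. v z < a"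
    and dvd: "\<And>z. int a dvd int n - int c * int z - int b * int (v z)"
    by metis
  have "inj_on v {k..<k + a}" for k
  proof (rule inj_onI)
    fix x y assume x: "x \<in> {k..<k + a}" and y: "y \<in> {k..<k + a}" and eq: "v x = v y"
    have "int a dvd (int n - int c * int x - int b * int (v x)) - (int n - int c * int y - int b * int (v y))"
      using dvd dvd_diff by blast
    also have "\<dots> = int c * (int y - int x)"
      by (simp add: eq algebra_simps)
    finally have "int a dvd int y - int x"
      using ac by (simp add: coprime_dvd_mult_right_iff)
    moreover have "\<bar>int y - int x\<bar> < int a"
      using x y by auto
    ultimately have "int y - int x = 0"
      using zdvd_not_zless[of "\<bar>int y - int x\<bar>" "int a"] by (cases "int y - int x = 0") auto
    then show "x = y" by simp
  qed
  with less dvd show thesis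
    by (rule that)
qed

text \<open>With \<open>t = (m - a u - b v) / (a b)\<close>, the solutions are
  \<open>(u + b i, v + a (t - i))\<close> for \<open>0 \<le> i \<le> t\<close>, so there are
  \<open>t + 1\<close> of them.\<close>

lemma card_two_variable_solutions:
  fixes a b m u v :: nat
  assumes a: "a > 0" and b: "b > 0" and ab: "coprime a b"
    and u: "u < b" and v: "v < a"
    and bu: "int b dvd int m - int a * int u" and av: "int a dvd int m - int b * int v"
  shows "int a * int b * int (card {(x, y). a * x + b * y = m})
    = int m + int a * int b - int a * int u - int b * int v"
proof -
  have "int b dvd (int m - int a * int u) - int b * int v"
    using bu by (rule dvd_diff) simp
  moreover have "int a dvd (int m - int b * int v) - int a * int u"
    using av by (rule dvd_diff) simp
  ultimately have "int a * int b dvd int m - int a * int u - int b * int v"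
    using ab by (intro divides_mult) (simp_all add: algebra_simps)
  then obtain t where t: "int m - int a * int u - int b * int v = int a * int b * t"
    by (auto elim: dvdE)
  have "int a * int u < int a * int b" "int b * int v < int b * int a"
    using a b u v by (simp_all add: zmult_zless_mono2)
  then have "int a * int b * (- 2) < int a * int b * t"
    using t by (simp add: algebra_simps)
  \<comment> \<open>So \<open>t + 1\<close> is nonnegative and \<open>nat (t + 1)\<close> loses
    nothing; \<open>t = -1\<close> is the case without solutions.\<close>
  then have t_ge: "- 2 < t"
    by (rule mult_left_less_imp_less) simp
  have "{(x, y). a * x + b * y = m} = (\<lambda>i. (u + b * i, v + a * (nat (t - int i)))) ` {..<nat (t + 1)}"
    (is "?S = ?T")
  proof
    show "?T \<subseteq> ?S"
    proof clarify
      fix i assume "i < nat (t + 1)"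
      then have i: "int (nat (t - int i)) = t - int i"
        by simp
      have "int (a * (u + b * i) + b * (v + a * nat (t - int i))) = int m"
        using t unfolding of_nat_add of_nat_mult i by (simp add: algebra_simps)
      then show "a * (u + b * i) + b * (v + a * nat (t - int i)) = m"
        by (simp only: of_nat_eq_iff)
    qed
    show "?S \<subseteq> ?T"
    proof (rule subrelI)
      fix x y assume "(x, y) \<in> ?S"
      then have m: "a * x + b * y = m"
        by simp
      have quotient: "\<exists>i. w = s + q * i"
        if "s < q" "coprime q p" "int q dvd int p * (int w - int s)" for p q s w :: nat
      proof -
        have "int q dvd int w - int s"
          using that by (simp add: coprime_dvd_mult_right_iff)
        then obtain j where j: "int w - int s = int q * j" by (auto elim: dvdE)
        \<comment> \<open>This holds since \<open>w \<ge> 0\<close> and \<open>s < q\<close>; hence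
          \<open>j\<close> is a natural number.\<close>
        have "int q * (- 1) < int q * j"
          using j that by linarith
        then have "- 1 < j"
          by (rule mult_left_less_imp_less) simp
        then have "int w = int (s + q * nat j)"
          using j by simp
        then show ?thesis
          by (metis of_nat_eq_iff)
      qed
      have m': "int m = int a * int x + int b * int y"
        using m by auto
      have "int b dvd (int m - int a * int u) - int b * int y"
        using bu by (rule dvd_diff) simp
      then have "int b dvd int a * (int x - int u)"
        by (simp add: m' algebra_simps)
      then obtain i where i: "x = u + b * i"
        using quotient u ab by (metis coprime_commute)
      have "int a dvd (int m - int b * int v) - int a * int x"
        using av by (rule dvd_diff) simp
      then have "int a dvd int b * (int y - int v)"
        by (simp add: m' algebra_simps)
      then obtain j where j: "y = v + a * j"
        using quotient v ab by metis
      have "int a * int b * (int i + int j) = int a * int b * t"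
        using t by (simp add: m' i j algebra_simps)
      then have "int i + int j = t"
        using a b by simp
      then have "i < nat (t + 1)" "j = nat (t - int i)"
        by auto
      then show "(x, y) \<in> ?T"
        using i j by auto
    qed
  qed
  moreover have "inj_on (\<lambda>i. (u + b * i, v + a * (nat (t - int i)))) {..<nat (t + 1)}"
    using b by (auto simp: inj_on_def)
  ultimately have "card ?S = nat (t + 1)"
    by (simp add: card_image)
  then show ?thesis
    using t t_ge by (simp add: algebra_simps)
qed

section \<open>Summation over \<open>z\<close> and the final estimate\<close>

lemma num_sols_eq_sum:
  fixes a b c n :: nat
  assumes "a > 0" "b > 0" "c > 0"
  shows "num_sols a b c n = (\<Sum>z<n div c + 1. card {(x, y). a * x + b * y = n - c * z})"
proof -
  have fin: "finite {(x, y). a * x + b * y = m}" for m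
  proof (rule finite_subset)
    show "{(x, y). a * x + b * y = m} \<subseteq> {..m} \<times> {..m}"
    proof clarify
      fix x y assume "m = a * x + b * y"
      moreover have "x \<le> a * x" "y \<le> b * y"
        using assms by auto
      ultimately show "x \<in> {..a * x + b * y} \<and> y \<in> {..a * x + b * y}"
        by (simp only: atMost_iff) linarith
    qed
  qed simp
  let ?P = "SIGMA z:{..<n div c + 1}. {(x, y). a * x + b * y = n - c * z}"
  \<comment> \<open>On this range of \<open>z\<close> the natural subtraction
    \<open>n - c * z\<close> is never truncated.\<close>
  have z_iff: "z < Suc (k div c) \<longleftrightarrow> c * z \<le> k" for z k
    using assms by (simp add: less_Suc_eq_le less_eq_div_iff_mult_less_eq mult.commute)
  have "bij_betw (\<lambda>(z, x, y). (x, y, z)) ?P {(x, y, z). a * x + b * y + c * z = n}"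
    by (rule bij_betw_byWitness[where f' = "\<lambda>(x, y, z). (z, x, y)"]) (auto simp: z_iff)
  then have "num_sols a b c n = card ?P"
    unfolding num_sols_def by (simp add: bij_betw_same_card)
  then show ?thesis
    using fin by simp
qed

theorem theorem2:
  fixes a b c n :: nat
  assumes "a > 0" and "b > 0" and "c > 0" and "n > 0"
    and "gcd a b = 1" and "gcd b c = 1" and "gcd c a = 1"
  shows "real n * (real n + real a + real b + real c) / (2 * real a * real b * real c)
           - (real a + real b + real c) / 2 < real (num_sols a b c n) \<and>
         real (num_sols a b c n)
           < real n * (real n + real a + real b + real c) / (2 * real a * real b * real c)
             + (real a + real b + real c) / 2"
proof -
  have cop: "coprime a b" "coprime b a" "coprime b c" "coprime a c"
    using assms by (simp_all add: coprime_iff_gcd_eq_1 gcd.commute)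
  obtain v where v: "\<And>z. v z < a" "\<And>z. int a dvd int n - int c * int z - int b * int (v z)"
      "\<And>k. inj_on v {k..<k + a}"
    using obtain_window_injective_residues[OF assms(1) cop(1) cop(4)] by blast
  obtain u where u: "\<And>z. u z < b" "\<And>z. int b dvd int n - int c * int z - int a * int (u z)"
      "\<And>k. inj_on u {k..<k + b}"
    using obtain_window_injective_residues[OF assms(2) cop(2) cop(3)] by blast
  define A B C X where "A = real a" and "B = real b" and "C = real c" and "X = real n"
  have pos: "A \<ge> 1" "B \<ge> 1" "C \<ge> 1"
    using assms by (auto simp: A_def B_def C_def)
  define L where "L = n div c + 1"
  define r where "r = real (n mod c)"
  have r: "0 \<le> r" "r < C"
    using assms by (auto simp: r_def C_def)
  have "n + c = c * L + n mod c"
    by (simp add: L_def algebra_simps)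
  then have "real (n + c) = real (c * L + n mod c)"
    by (simp only:)
  then have L: "C * real L = X + C - r"
    by (simp add: C_def X_def r_def)
  define V where "V = (\<Sum>z<L. real (v z) - (A - 1) / 2)"
  define U where "U = (\<Sum>z<L. real (u z) - (B - 1) / 2)"
  have V: "\<bar>V\<bar> \<le> A\<^sup>2 / 8" and U: "\<bar>U\<bar> \<le> B\<^sup>2 / 8"
    unfolding V_def U_def A_def B_def
    by (rule sum_windowed_residues_deviation[OF v(3) v(1)]
             sum_windowed_residues_deviation[OF u(3) u(1)])+
  have term_eq: "A * B * real (card {(x, y). a * x + b * y = n - c * z})
      = X - C * real z + (A + B) / 2
        - A * (real (u z) - (B - 1) / 2) - B * (real (v z) - (A - 1) / 2)" if "z < L" for z
  proof -
    have "c * z \<le> n"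
      using that assms by (simp add: L_def less_Suc_eq_le less_eq_div_iff_mult_less_eq mult.commute)
    then have m: "int (n - c * z) = int n - int c * int z"
      by (simp add: of_nat_diff)
    have "int a * int b * int (card {(x, y). a * x + b * y = n - c * z})
        = int n - int c * int z + int a * int b - int a * int (u z) - int b * int (v z)"
      using card_two_variable_solutions[of a b "u z" "v z" "n - c * z"] assms cop u v m by simp
    then have "real_of_int (int a * int b * int (card {(x, y). a * x + b * y = n - c * z}))
        = real_of_int (int n - int c * int z + int a * int b - int a * int (u z) - int b * int (v z))"
      by (simp only:)
    then have "A * B * real (card {(x, y). a * x + b * y = n - c * z})
        = X - C * real z + A * B - A * real (u z) - B * real (v z)"
      by (simp add: A_def B_def C_def X_def)
    then show ?thesis
      by (simp add: field_simps)
  qed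
  have gauss: "(\<Sum>z<k. real z) = real k * (real k - 1) / 2" for k
    by (induction k) (auto simp: field_simps)
  define N where "N = real (num_sols a b c n)"
  have "A * B * N = (\<Sum>z<L. A * B * real (card {(x, y). a * x + b * y = n - c * z}))"
    using num_sols_eq_sum[OF assms(1-3), of n] by (simp only: N_def L_def of_nat_sum sum_distrib_left)
  also have "\<dots> = (\<Sum>z<L. X - C * real z + (A + B) / 2
        - A * (real (u z) - (B - 1) / 2) - B * (real (v z) - (A - 1) / 2))"
    by (rule sum.cong) (use term_eq in auto)
  also have "\<dots> = real L * (X + (A + B) / 2) - C * (\<Sum>z<L. real z) - A * U - B * V"
    unfolding U_def V_def sum_subtractf sum.distrib
    by (simp add: sum_subtractf algebra_simps flip: sum_distrib_left)
  finally have ABN: "A * B * N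
      = real L * (X + (A + B) / 2) - C * (real L * (real L - 1) / 2) - A * U - B * V"
    by (simp only: gauss)
  \<comment> \<open>After multiplication by \<open>2 C\<close>, \<open>L\<close> enters the main
    part only through \<open>C L\<close>, which equals \<open>X + C - r\<close>.\<close>
  have "2 * C * (A * B * N)
      = (C * real L) * (2 * X + A + B + C) - (C * real L)\<^sup>2 - 2 * C * (A * U + B * V)"
    unfolding ABN by (simp add: field_simps power2_eq_square)
  also have "\<dots> = X * (X + A + B + C) + (C - r) * (r + A + B) - 2 * C * (A * U + B * V)"
    unfolding L by (simp add: algebra_simps power2_eq_square)
  finally have N: "2 * A * B * C * N
      = X * (X + A + B + C) + (C - r) * (r + A + B) - 2 * C * (A * U + B * V)"
    by (simp add: algebra_simps)
  \<comment> \<open>The error is \<open>E / (2 A B C)\<close>, so the claim amounts to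
    \<open>\<bar>E\<bar> < A B C (A + B + C)\<close>.\<close>
  define E where "E = (C - r) * (r + A + B) - 2 * C * (A * U + B * V)"
  have "A * \<bar>U\<bar> \<le> A * (B\<^sup>2 / 8)" "B * \<bar>V\<bar> \<le> B * (A\<^sup>2 / 8)"
    using U V pos by (auto intro!: mult_left_mono)
  moreover have "\<bar>A * U + B * V\<bar> \<le> A * \<bar>U\<bar> + B * \<bar>V\<bar>"
    using pos abs_triangle_ineq[of "A * U" "B * V"] by (simp add: abs_mult)
  ultimately have "\<bar>A * U + B * V\<bar> \<le> A * B * (A + B) / 8"
    by (simp add: power2_eq_square algebra_simps)
  then have "2 * C * \<bar>A * U + B * V\<bar> \<le> 2 * C * (A * B * (A + B) / 8)"
    using pos by (intro mult_left_mono) auto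
  moreover have "\<bar>2 * C * (A * U + B * V)\<bar> = 2 * C * \<bar>A * U + B * V\<bar>"
    using pos by (simp add: abs_mult)
  ultimately have UV: "\<bar>2 * C * (A * U + B * V)\<bar> \<le> A * B * C * (A + B) / 4"
    by (simp add: algebra_simps)
  have ABC: "A * B * C > 0" "A * B \<ge> 1" "B * C \<ge> 1" "A * C \<ge> 1"
    using pos by (auto intro!: mult_pos_pos simp: mult_ge1_I)
  have "0 \<le> (C - r) * (r + A + B)"
    using r pos by simp
  moreover have "A * B * C * (A + B) / 4 < A * B * C * (A + B + C)"
    using ABC(1) pos by (simp add: mult_less_cancel_left_pos flip: times_divide_eq_right)
  ultimately have lower: "- (A * B * C * (A + B + C)) < E"
    using UV unfolding E_def by linarith
  have "(C - r) * (r + A + B) = (C - r) * r + (C - r) * (A + B)"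
    by (simp add: algebra_simps)
  also have "(C - r) * r \<le> C * C / 4"
    using zero_le_power2[of "C - 2 * r"] by (simp add: power2_eq_square algebra_simps)
  also have "(C - r) * (A + B) \<le> C * (A + B)"
    using r pos by (intro mult_right_mono) auto
  finally have main: "(C - r) * (r + A + B) \<le> C * (C / 4 + (A + B))"
    by (simp add: algebra_simps)
  \<comment> \<open>The right side is what remains of \<open>A B (A + B + C)\<close> once the bound
    \<open>A B (A + B) / 4\<close> from \<open>UV\<close>, divided by \<open>C\<close>, is taken
    away.\<close>
  have "C / 4 + (A + B) < A * B * (3 * (A + B) / 4 + C)"
  proof -
    have "C / 4 \<le> A * B * (C / 4)"
      using mult_right_mono[OF ABC(2), of "C / 4"] pos by simp
    moreover have "(A - 1) * (B - 1) \<ge> 0"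
      using pos by simp
    then have "A + B \<le> A * B + 1"
      by (simp add: algebra_simps)
    moreover have "A * B * 2 \<le> A * B * (A + B)"
      using ABC pos by (intro mult_left_mono) auto
    moreover have "A * B \<le> A * B * C"
      using ABC pos mult_left_mono[of 1 C "A * B"] by simp
    moreover have "A * B * (3 * (A + B) / 4 + C) = 3 / 4 * (A * B * (A + B)) + A * B * C"
      by (simp add: algebra_simps)
    ultimately show ?thesis
      using ABC by linarith
  qed
  then have "C * (C / 4 + (A + B)) < C * (A * B * (3 * (A + B) / 4 + C))"
    using pos by simp
  moreover have "C * (A * B * (3 * (A + B) / 4 + C)) + A * B * C * (A + B) / 4
      = A * B * C * (A + B + C)"
    by (simp add: field_simps)
  ultimately have upper: "E < A * B * C * (A + B + C)"
    using main UV unfolding E_def by linarith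
  have D: "2 * A * B * C > 0"
    using ABC(1) by simp
  have "2 * A * B * C * N = X * (X + A + B + C) + E"
    using N by (simp add: E_def)
  then have "N = X * (X + A + B + C) / (2 * A * B * C) + E / (2 * A * B * C)"
    using D by (metis add_divide_distrib less_irrefl nonzero_mult_div_cancel_left)
  moreover have "E / (2 * A * B * C) < (A + B + C) / 2"
    using upper D by (simp add: pos_divide_less_eq algebra_simps)
  moreover have "- ((A + B + C) / 2) < E / (2 * A * B * C)"
    proof -
    have "- ((A + B + C) / 2) * (2 * A * B * C) = - (A * B * C * (A + B + C))"
      by (simp add: field_simps)
    then show ?thesis
      using lower D by (simp only: pos_less_divide_eq)
  qed
  ultimately show ?thesis
    unfolding A_def B_def C_def X_def N_def by linarith
qed

end
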